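(* Let $r=2$, $s=(\sqrt5-1)/2$, and $t=(1+\sqrt5)/2$, and for integers $n\ge1$ define \begin{align*} a(n)&=n+\lfloor ns/r\rfloor+\lfloor nt/r\rfloor,\\ b(n)&=n+\lfloor nr/s\rfloor+\lfloor nt/s\rfloor,\\ c(n)&=n+\lfloor nr/t\rfloor+\lfloor ns/t\rfloor. \end{align*} Let $\mathbf{f}=\mathbf{f}[0]\mathbf{f}[1]\mathbf{f}[2]\cdots$ be the Fibonacci word. For an integer $d\ge1$ consider the conditions (i) there exists $i\ge 0$ such that $\mathbf{f}[i]=\mathbf{f}[i+d]=\mathbf{f}[i+2d]=0$; (ii) there exists $j\ge 0$ such that $\mathbf{f}[j]=\mathbf{f}[j+d]=\mathbf{f}[j+2d]=1$. Then for every integer $n\ge 1$: (a) there exists $m\ge 1$ such that $n=a(m)$ if and only if (i) holds for $d=n+1$ but (ii) does not hold for $d=n+1$; (b) there exists $m\ge 1$ such that $n=b(m)$ if and only if neither (i) nor (ii) holds for $d=n+1$; (c) there exists $m\ge 1$ such that $n=c(m)$ if and only if both (i) and (ii) hold for $d=n+1$.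
   Context: The Fibonacci word $\mathbf{f}=01001010\cdots$, indexed from position $0$, is the infinite word over $\{0,1\}$ that is the fixed point of the morphism $0\mapsto 01$, $1\mapsto 0$. *)

theory Defs
  imports Complex_Main "HOL-Library.Stream"
begin

definition fib_morphism :: "nat \<Rightarrow> nat list" where
  "fib_morphism x = (if x = 0 then [0, 1] else [0])"

(* A non-erasing morphism acts on infinite words by concatenating the images of the letters. *)
definition morphism_stream :: "('a \<Rightarrow> 'a list) \<Rightarrow> 'a stream \<Rightarrow> 'a stream" where
  "morphism_stream h w = flat (smap h w)"

(* Existence and uniqueness of the fixed point are proved in fib_word_ex1 below. *)
definition fib_word :: "nat stream" where
  "fib_word = (THE w. w \<in> streams {0, 1} \<and> morphism_stream fib_morphism w = w)"

definition equal_letters_at_distance :: "'a stream \<Rightarrow> 'a \<Rightarrow> nat \<Rightarrow> bool" where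
  "equal_letters_at_distance w x d \<longleftrightarrow>
     (\<exists>i. w !! i = x \<and> w !! (i + d) = x \<and> w !! (i + 2 * d) = x)"

lemma fib_morphism_nonempty [simp]: "fib_morphism x \<noteq> []"
  by (simp add: fib_morphism_def)

definition fib_morphism_list :: "nat list \<Rightarrow> nat list" where
  "fib_morphism_list u = concat (map fib_morphism u)"

lemma fib_morphism_list_append [simp]:
  "fib_morphism_list (u @ v) = fib_morphism_list u @ fib_morphism_list v"
  by (simp add: fib_morphism_list_def)

lemma fib_morphism_list_pow_append:
  "(fib_morphism_list ^^ n) (u @ v) = (fib_morphism_list ^^ n) u @ (fib_morphism_list ^^ n) v"
  by (induction n) auto

lemma fib_morphism_list_pow_nonempty: "u \<noteq> [] \<Longrightarrow> (fib_morphism_list ^^ n) u \<noteq> []"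
  by (induction n) (auto simp: fib_morphism_list_def neq_Nil_conv)

lemma morphism_stream_shift:
  "morphism_stream fib_morphism (u @- w) = fib_morphism_list u @- morphism_stream fib_morphism w"
  by (induction u) (auto simp: morphism_stream_def fib_morphism_list_def)

lemma morphism_stream_pow_shift:
  "(morphism_stream fib_morphism ^^ n) (u @- w) =
     (fib_morphism_list ^^ n) u @- (morphism_stream fib_morphism ^^ n) w"
  by (induction n) (auto simp: morphism_stream_shift)

abbreviation fib_prefix :: "nat \<Rightarrow> nat list" where
  "fib_prefix n \<equiv> (fib_morphism_list ^^ n) [0]"

lemma fib_prefix_Suc: "fib_prefix (Suc n) = fib_prefix n @ (fib_morphism_list ^^ n) [1]"
proof -
  have "fib_prefix (Suc n) = (fib_morphism_list ^^ n) (fib_morphism_list [0])"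
    by (simp add: funpow_swap1)
  also have "fib_morphism_list [0] = [0] @ [1]"
    by (simp add: fib_morphism_list_def fib_morphism_def)
  finally show ?thesis by (simp only: fib_morphism_list_pow_append)
qed

lemma length_fib_prefix: "n < length (fib_prefix n)"
proof (induction n)
  case (Suc n)
  have "length ((fib_morphism_list ^^ n) [1]) > 0"
    using fib_morphism_list_pow_nonempty by blast
  with Suc show ?case unfolding fib_prefix_Suc length_append by linarith
qed simp

lemma fib_prefix_mono: "m \<le> n \<Longrightarrow> \<exists>v. fib_prefix n = fib_prefix m @ v"
proof (induction rule: dec_induct)
  case (step n)
  then show ?case unfolding fib_prefix_Suc by auto
qed simp

lemma fib_prefix_nth:
  assumes "i < length (fib_prefix m)" "i < length (fib_prefix n)"
  shows "fib_prefix m ! i = fib_prefix n ! i"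
proof (cases "m \<le> n")
  case True
  then obtain v where "fib_prefix n = fib_prefix m @ v" using fib_prefix_mono by blast
  with assms show ?thesis by (simp add: nth_append)
next
  case False
  then obtain v where "fib_prefix m = fib_prefix n @ v" using fib_prefix_mono nat_le_linear by blast
  with assms show ?thesis by (simp add: nth_append)
qed

lemma fib_fixed_point_nth:
  assumes "morphism_stream fib_morphism w = w"
  shows "w !! n = fib_prefix n ! n"
proof -
  have hd: "shd (morphism_stream fib_morphism w) = 0"
    by (simp add: morphism_stream_def fib_morphism_def)
  then have w: "w = [0] @- stl w" using assms by (simp add: stream.expand)
  have "(morphism_stream fib_morphism ^^ n) w = w"
    using assms by (induction n) auto
  then have "w = fib_prefix n @- (morphism_stream fib_morphism ^^ n) (stl w)"
    using morphism_stream_pow_shift[of n "[0]" "stl w"] w by metis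
  then show ?thesis using length_fib_prefix shift_snth_less by metis
qed

lemma fib_word_ex1: "\<exists>!w. w \<in> streams {0, 1} \<and> morphism_stream fib_morphism w = w"
proof (rule ex_ex1I)
  define w where "w = smap (\<lambda>i. fib_prefix i ! i) nats"
  have w_nth: "w !! i = fib_prefix i ! i" for i by (simp add: w_def)
  have pre: "w = fib_prefix n @- sdrop (length (fib_prefix n)) w" for n
  proof -
    have "stake (length (fib_prefix n)) w = fib_prefix n"
      by (rule nth_equalityI)
        (auto simp: w_nth length_fib_prefix intro: fib_prefix_nth)
    then show ?thesis using stake_sdrop[of "length (fib_prefix n)" w] by simp
  qed
  have "morphism_stream fib_morphism w !! i = w !! i" for i
  proof -
    have "morphism_stream fib_morphism w =
        fib_prefix (Suc i) @- morphism_stream fib_morphism (sdrop (length (fib_prefix i)) w)"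
      using morphism_stream_shift[of "fib_prefix i"] pre[of i] by (metis comp_apply funpow.simps(2))
    moreover have "i < length (fib_prefix (Suc i))"
      using length_fib_prefix[of "Suc i"] by linarith
    ultimately show ?thesis
      using fib_prefix_nth[of i "Suc i" i] length_fib_prefix[of i] by (metis shift_snth_less w_nth)
  qed
  then have fp: "morphism_stream fib_morphism w = w"
    by (metis smap_alt stream.map_id0 id_apply)
  have "sset (morphism_stream fib_morphism w) \<subseteq> {0, 1}"
    unfolding morphism_stream_def
    by (subst sset_flat) (auto simp: stream.set_map fib_morphism_def split: if_splits)
  then have "w \<in> streams {0, 1}" using fp by (simp add: streams_iff_sset)
  with fp show "\<exists>w. w \<in> streams {0, 1} \<and> morphism_stream fib_morphism w = w" by blast
next
  fix v w
  assume "v \<in> streams {0, 1} \<and> morphism_stream fib_morphism v = v"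
    and "w \<in> streams {0, 1} \<and> morphism_stream fib_morphism w = w"
  then have "v !! n = w !! n" for n by (simp add: fib_fixed_point_nth)
  then show "v = w" by (metis smap_alt stream.map_id0 id_apply)
qed

lemma fib_word_fixed_point:
  "fib_word \<in> streams {0, 1}" "morphism_stream fib_morphism fib_word = fib_word"
  using theI'[OF fib_word_ex1] by (auto simp: fib_word_def)

end

theory Submission
  imports Defs "HOL-Analysis.Kronecker_Approximation_Theorem"
begin

text \<open>
  Write \<open>\<sigma> = (sqrt 5 - 1) / 2\<close>. The Fibonacci word codes the rotation by \<open>\<sigma>\<close>: its letter at position
  \<open>i\<close> is \<open>1\<close> iff the fractional part of \<open>(i + 1) \<sigma>\<close> lies below \<open>1 - \<sigma>\<close>. By density of the orbit, whether
  three equal letters occur at distance \<open>d\<close> depends only on the distance \<open>\<epsilon>\<close> of \<open>d \<sigma>\<close> to the nearest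
  integer: three ones occur iff \<open>\<epsilon> < (1 - \<sigma>) / 2\<close>, and three zeros occur iff \<open>\<epsilon> < \<sigma> / 2\<close> or
  \<open>\<epsilon> > 1 - \<sigma>\<close>. Evaluating \<open>(n + 1) \<sigma>\<close> modulo one for \<open>n\<close> in each of the three sequences gives the
  forward implications. For the converses, the three combinations of conditions exclude each other,
  and every \<open>n \<ge> 1\<close> is a term of one of the sequences, because these list the ranks of the multiples
  of \<open>1 / r\<close>, of \<open>1 / s\<close> and of \<open>1 / t\<close> in the union of all three sets of multiples.
\<close>

section \<open>The number \<sigma>: irrationality, and density of its multiples modulo one\<close>

definition golden_conj :: real ("\<sigma>") where
  "\<sigma> = (sqrt 5 - 1) / 2"

lemma golden_conj_sq: "\<sigma> * \<sigma> = 1 - \<sigma>"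
  by (simp add: golden_conj_def field_simps)

lemma golden_conj_bounds: "618 / 1000 < \<sigma>" "\<sigma> < 619 / 1000"
proof -
  have "2236 / 1000 < sqrt 5" by (rule real_less_rsqrt) (simp add: power2_eq_square)
  moreover have "sqrt 5 < 2238 / 1000" by (rule real_less_lsqrt) (simp_all add: power2_eq_square)
  ultimately show "618 / 1000 < \<sigma>" "\<sigma> < 619 / 1000" by (simp_all add: golden_conj_def)
qed

lemma golden_conj_irrational: "\<sigma> \<notin> \<rat>"
proof
  assume "\<sigma> \<in> \<rat>"
  then obtain m n :: nat where n: "n \<noteq> 0" and mn: "\<bar>\<sigma>\<bar> = real m / real n" and cop: "coprime m n"
    by (rule Rats_abs_nat_div_natE)
  from mn n golden_conj_bounds have s: "\<sigma> = real m / real n" by simp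
  from golden_conj_sq n have "real m * real m = real n * real n - real m * real n"
    unfolding s by (simp add: field_simps)
  then have "real (m * m + m * n) = real (n * n)" by simp
  then have "m * m + m * n = n * n" by (simp only: of_nat_eq_iff)
  \<comment> \<open>If \<open>n\<close> were odd, both factors of \<open>m * (m + n)\<close> would
    be odd, which is impossible. So \<open>n\<close> is even, hence so is
    \<open>m * m\<close>.\<close>
  then have "even m \<and> even n" by (metis even_add even_mult_iff)
  with cop show False by (meson coprime_common_divisor_nat dvd_refl odd_one coprime_def)
qed

lemma golden_conj_mult_not_int:
  assumes "k \<noteq> 0"
  shows "real k * \<sigma> \<noteq> of_int z"
proof
  assume "real k * \<sigma> = of_int z"
  with assms have eq: "\<sigma> = of_int z / of_nat k" by (simp add: field_simps)
  have "\<sigma> \<in> \<rat>" unfolding eq by simp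
  with golden_conj_irrational show False by simp
qed

text \<open>Kronecker approximation of the midpoint with half the length as tolerance. The index
  \<open>i + 1\<close> matches the angle that decides the letter at position
  \<open>i\<close>.\<close>

lemma golden_conj_dense:
  assumes "0 \<le> p" "p < q" "q \<le> 1"
  obtains i :: nat and z :: int where "p < real (i + 1) * \<sigma> - of_int z" "real (i + 1) * \<sigma> - of_int z < q"
proof -
  obtain k :: nat where "k > 0" and k: "\<bar>frac (real k * \<sigma>) - (p + q) / 2\<bar> < (q - p) / 2"
    using Kronecker_approx_1_explicit[OF golden_conj_irrational, of "(p + q) / 2" "(q - p) / 2"] assms
    by auto
  from \<open>k > 0\<close> have "k - 1 + 1 = k" by simp
  with k show ?thesis
    using that[of "k - 1" "\<lfloor>real k * \<sigma>\<rfloor>"] unfolding frac_def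
    by (auto simp: abs_less_iff field_simps)
qed

subsection \<open>The Fibonacci word as a rotation coding\<close>

definition rotation_word :: "nat stream" where
  "rotation_word = smap (\<lambda>i. if frac (real (i + 1) * \<sigma>) < 1 - \<sigma> then 1 else 0) nats"

lemma rotation_word_nth:
  "rotation_word !! i = (if frac (real (i + 1) * \<sigma>) < 1 - \<sigma> then 1 else 0)"
  by (simp add: rotation_word_def)

lemma rotation_word_nth_one:
  assumes "0 \<le> real (i + 1) * \<sigma> - of_int z" "real (i + 1) * \<sigma> - of_int z < 1 - \<sigma>"
  shows "rotation_word !! i = 1"
proof -
  have "frac (real (i + 1) * \<sigma>) = real (i + 1) * \<sigma> - of_int z"
    using assms golden_conj_bounds by (simp add: frac_unique_iff)
  with assms show ?thesis by (simp add: rotation_word_nth)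
qed

lemma rotation_word_nth_zero:
  assumes "1 - \<sigma> \<le> real (i + 1) * \<sigma> - of_int z" "real (i + 1) * \<sigma> - of_int z < 1"
  shows "rotation_word !! i = 0"
proof -
  have "frac (real (i + 1) * \<sigma>) = real (i + 1) * \<sigma> - of_int z"
    using assms golden_conj_bounds by (simp add: frac_unique_iff)
  with assms show ?thesis by (simp add: rotation_word_nth)
qed

text \<open>The length of the image of the prefix of length \<open>n\<close>: each letter contributes one, and each
  of the \<open>\<lfloor>(n + 1) \<sigma>\<rfloor>\<close> zeros one more.\<close>
definition image_length :: "nat \<Rightarrow> nat" where
  "image_length n = n + nat \<lfloor>real (n + 1) * \<sigma>\<rfloor>"

lemma image_length_0: "image_length 0 = 0"
  using golden_conj_bounds by (simp add: image_length_def floor_eq_iff)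

text \<open>Adding \<sigma> raises the floor by one exactly when the fractional part is at least
  \<open>1 - \<sigma>\<close>, that is, when the letter is zero.\<close>

lemma image_length_Suc:
  "image_length (Suc n) = image_length n + (if rotation_word !! n = 0 then 2 else 1)"
proof -
  define F where "F = \<lfloor>real (n + 1) * \<sigma>\<rfloor>"
  have F: "of_int F \<le> real (n + 1) * \<sigma>" "real (n + 1) * \<sigma> < of_int F + 1"
    unfolding F_def by linarith+
  have "F \<ge> 0" unfolding F_def using golden_conj_bounds by simp
  have eq: "real (Suc n + 1) * \<sigma> = real (n + 1) * \<sigma> + \<sigma>" by (simp add: algebra_simps)
  show ?thesis
  proof (cases "real (n + 1) * \<sigma> - of_int F < 1 - \<sigma>")
    case True
    then have "rotation_word !! n = 1" using F by (intro rotation_word_nth_one[where z = F]) auto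
    moreover have "\<lfloor>real (Suc n + 1) * \<sigma>\<rfloor> = F"
      unfolding floor_eq_iff eq using F True golden_conj_bounds by linarith
    ultimately show ?thesis by (simp add: image_length_def F_def)
  next
    case False
    then have "rotation_word !! n = 0" using F by (intro rotation_word_nth_zero[where z = F]) auto
    moreover have F1: "\<lfloor>real (Suc n + 1) * \<sigma>\<rfloor> = F + 1"
      unfolding floor_eq_iff eq using F False golden_conj_bounds by simp
    moreover have "image_length (Suc n) = image_length n + 2"
      unfolding image_length_def F1 F_def[symmetric] using \<open>F \<ge> 0\<close> by (simp add: nat_add_distrib)
    ultimately show ?thesis by simp
  qed
qed

text \<open>The self-similarity of the rotation: if \<open>x\<close> is the fractional part for
  position \<open>n\<close>, then \<open>\<sigma> * \<sigma> = 1 - \<sigma>\<close> makes the angles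
  at the two positions from \<open>image_length n\<close> on congruent to
  \<open>- x * \<sigma>\<close> and \<open>\<sigma> - x * \<sigma>\<close>. The first always codes
  zero; the second codes one when \<open>x > 1 - \<sigma>\<close>.\<close>

lemma rotation_word_image_length:
  shows "rotation_word !! image_length n = 0"
    and "rotation_word !! n = 0 \<Longrightarrow> rotation_word !! (image_length n + 1) = 1"
proof -
  define F where "F = \<lfloor>real (n + 1) * \<sigma>\<rfloor>"
  define x where "x = real (n + 1) * \<sigma> - of_int F"
  have x: "0 \<le> x" "x < 1" unfolding x_def F_def by linarith+
  have "F \<ge> 0" unfolding F_def using golden_conj_bounds by simp
  then have L: "real (image_length n) = real n + of_int F" by (simp add: image_length_def F_def)
  have Fs: "of_int F * \<sigma> = real (n + 1) * (1 - \<sigma>) - x * \<sigma>"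
  proof -
    have "(of_int F + x) * \<sigma> = real (n + 1) * (\<sigma> * \<sigma>)" by (simp add: x_def)
    then show ?thesis unfolding golden_conj_sq by (simp add: algebra_simps)
  qed
  have eq: "real (image_length n + 1) * \<sigma> - of_int (int n) = 1 - x * \<sigma>"
    unfolding of_nat_add L using Fs by (simp add: algebra_simps)
  have eq2: "real (image_length n + 1 + 1) * \<sigma> - of_int (int n + 1) = \<sigma> - x * \<sigma>"
    using eq by (simp add: algebra_simps)
  have "x \<noteq> 0" using golden_conj_mult_not_int[of "n + 1" F] by (simp add: x_def)
  with x have "0 < x * \<sigma>" "x * \<sigma> < \<sigma>" using golden_conj_bounds by simp_all
  then show "rotation_word !! image_length n = 0"
    using eq golden_conj_bounds x by (intro rotation_word_nth_zero[where z = "int n"]) auto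
  assume "rotation_word !! n = 0"
  then have "x \<ge> 1 - \<sigma>" by (auto simp: rotation_word_nth frac_def x_def F_def split: if_splits)
  \<comment> \<open>Equality would make \<open>(n + 2) * \<sigma>\<close> the integer
    \<open>F + 1\<close>.\<close>
  moreover have "x \<noteq> 1 - \<sigma>"
    using golden_conj_mult_not_int[of "n + 2" "F + 1"] by (auto simp: x_def algebra_simps)
  ultimately have "\<sigma> * (1 - x) < \<sigma> * \<sigma>" using golden_conj_bounds by (intro mult_strict_left_mono) auto
  then have "\<sigma> - x * \<sigma> < 1 - \<sigma>" using golden_conj_sq by (simp add: algebra_simps)
  then show "rotation_word !! (image_length n + 1) = 1"
    using eq2 \<open>x * \<sigma> < \<sigma>\<close> by (intro rotation_word_nth_one[where z = "int n + 1"]) auto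
qed

lemma fib_morphism_list_stake_rotation_word:
  "fib_morphism_list (stake n rotation_word) = stake (image_length n) rotation_word"
proof (induction n)
  case 0
  then show ?case by (simp add: image_length_0 fib_morphism_list_def)
next
  case (Suc n)
  have "stake (Suc n) rotation_word = stake n rotation_word @ [rotation_word !! n]"
    by (rule stake_Suc)
  then have "fib_morphism_list (stake (Suc n) rotation_word) =
      stake (image_length n) rotation_word @ fib_morphism (rotation_word !! n)"
    using Suc by (simp add: fib_morphism_list_def)
  also have "\<dots> = stake (image_length (Suc n)) rotation_word"
  proof (cases "rotation_word !! n = 0")
    case True
    then have "image_length (Suc n) = Suc (Suc (image_length n))" by (simp add: image_length_Suc)
    then have "stake (image_length (Suc n)) rotation_word = stake (image_length n) rotation_word @
        [rotation_word !! image_length n] @ [rotation_word !! Suc (image_length n)]"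
      by (simp only: stake_Suc append_assoc)
    moreover have "rotation_word !! Suc (image_length n) = 1"
      using rotation_word_image_length(2)[OF True] by (simp only: Suc_eq_plus1)
    ultimately show ?thesis
      using True rotation_word_image_length(1)[of n] by (simp only: fib_morphism_def) simp
  next
    case False
    then have "image_length (Suc n) = Suc (image_length n)" by (simp add: image_length_Suc)
    then have "stake (image_length (Suc n)) rotation_word =
        stake (image_length n) rotation_word @ [rotation_word !! image_length n]"
      by (simp only: stake_Suc)
    then show ?thesis
      using False rotation_word_image_length(1)[of n] by (simp add: fib_morphism_def)
  qed
  finally show ?case .
qed

text \<open>By uniqueness it is enough that the rotation word is a fixed point. Its letter
  \<open>i\<close> can be read off the image of the prefix of length \<open>Suc i\<close>, which is
  again a prefix and is longer than \<open>i\<close>.\<close>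

lemma fib_word_eq_rotation_word: "fib_word = rotation_word"
  unfolding fib_word_def
proof (rule the1_equality[OF fib_word_ex1], rule conjI)
  show "rotation_word \<in> streams {0, 1}"
    by (auto simp: streams_iff_sset rotation_word_def stream.set_map)
  have "morphism_stream fib_morphism rotation_word !! i = rotation_word !! i" for i
  proof -
    have "i < image_length (Suc i)" by (simp add: image_length_def)
    have "morphism_stream fib_morphism rotation_word =
        stake (image_length (Suc i)) rotation_word @-
          morphism_stream fib_morphism (sdrop (Suc i) rotation_word)"
      by (metis fib_morphism_list_stake_rotation_word morphism_stream_shift stake_sdrop)
    with \<open>i < image_length (Suc i)\<close> show ?thesis by (metis length_stake shift_snth_less stake_nth)
  qed
  then show "morphism_stream fib_morphism rotation_word = rotation_word"
    by (metis smap_alt stream.map_id0 id_apply)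
qed

lemma fib_word_nth_one:
  assumes "0 \<le> real (i + 1) * \<sigma> - of_int z" "real (i + 1) * \<sigma> - of_int z < 1 - \<sigma>"
  shows "fib_word !! i = 1"
  using rotation_word_nth_one[OF assms] by (simp add: fib_word_eq_rotation_word)

lemma fib_word_nth_zero:
  assumes "1 - \<sigma> \<le> real (i + 1) * \<sigma> - of_int z" "real (i + 1) * \<sigma> - of_int z < 1"
  shows "fib_word !! i = 0"
  using rotation_word_nth_zero[OF assms] by (simp add: fib_word_eq_rotation_word)

lemma fib_word_nth_oneD:
  assumes "fib_word !! i = 1"
  obtains z where "0 \<le> real (i + 1) * \<sigma> - of_int z" "real (i + 1) * \<sigma> - of_int z < 1 - \<sigma>"
proof (rule that)
  have "frac (real (i + 1) * \<sigma>) < 1 - \<sigma>"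
    using assms by (simp add: fib_word_eq_rotation_word rotation_word_nth split: if_splits)
  then show "real (i + 1) * \<sigma> - of_int \<lfloor>real (i + 1) * \<sigma>\<rfloor> < 1 - \<sigma>" by (simp add: frac_def)
qed simp

lemma fib_word_nth_zeroD:
  assumes "fib_word !! i = 0"
  obtains z where "1 - \<sigma> \<le> real (i + 1) * \<sigma> - of_int z" "real (i + 1) * \<sigma> - of_int z < 1"
proof (rule that)
  have "\<not> frac (real (i + 1) * \<sigma>) < 1 - \<sigma>"
    using assms by (auto simp: fib_word_eq_rotation_word rotation_word_nth split: if_splits)
  then show "1 - \<sigma> \<le> real (i + 1) * \<sigma> - of_int \<lfloor>real (i + 1) * \<sigma>\<rfloor>" by (simp add: frac_def)
  show "real (i + 1) * \<sigma> - of_int \<lfloor>real (i + 1) * \<sigma>\<rfloor> < 1" by linarith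
qed

subsection \<open>Equal letters at a given distance\<close>

text \<open>Here \<open>u\<close> is any representative of \<open>d * \<sigma>\<close> modulo one,
  not necessarily the nearest to zero, so each application can choose the convenient one.\<close>

context
  fixes d :: nat and z :: int and u :: real
  assumes u: "real d * \<sigma> = u + of_int z"
begin

lemma rotation_shift:
  "real (i + d + 1) * \<sigma> = real (i + 1) * \<sigma> + u + of_int z"
  "real (i + 2 * d + 1) * \<sigma> = real (i + 1) * \<sigma> + 2 * u + 2 * of_int z"
  using u by (simp_all add: algebra_simps)

text \<open>The interval for \<open>x\<close> puts both \<open>x\<close> and
  \<open>x + 2 * u\<close> in \<open>[0, 1 - \<sigma>)\<close>; convexity takes care of
  \<open>x + u\<close>. It is nonempty because
  \<open>2 * \<bar>u\<bar> < 1 - \<sigma>\<close>.\<close>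

lemma equal_ones_at_distance:
  assumes "\<bar>u\<bar> < (1 - \<sigma>) / 2"
  shows "equal_letters_at_distance fib_word 1 d"
proof -
  obtain i and k :: int where
    x: "max 0 (- 2 * u) < real (i + 1) * \<sigma> - of_int k"
       "real (i + 1) * \<sigma> - of_int k < min (1 - \<sigma>) (1 - \<sigma> - 2 * u)"
    by (rule golden_conj_dense[of "max 0 (- 2 * u)" "min (1 - \<sigma>) (1 - \<sigma> - 2 * u)"])
      (use assms golden_conj_bounds in auto)
  have "fib_word !! i = 1" using x by (intro fib_word_nth_one[where z = k]) auto
  moreover have "fib_word !! (i + d) = 1"
    using x by (intro fib_word_nth_one[where z = "k + z"];
      simp only: rotation_shift of_int_add of_int_mult of_int_numeral of_int_1; linarith)
  moreover have "fib_word !! (i + 2 * d) = 1"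
    using x by (intro fib_word_nth_one[where z = "k + 2 * z"];
      simp only: rotation_shift of_int_add of_int_mult of_int_numeral of_int_1; linarith)
  ultimately show ?thesis unfolding equal_letters_at_distance_def by blast
qed

text \<open>Both steps between consecutive points are shorter than
  \<open>1 - \<sigma> < 1 / 2\<close>, so they wrap by the same integer and the total wrap
  \<open>l2\<close> is even. But then \<open>2 * u\<close> would be closer than
  \<open>1 - \<sigma>\<close> to an even integer, against the bounds on \<open>u\<close>.\<close>

lemma not_equal_ones_at_distance:
  assumes "(1 - \<sigma>) / 2 \<le> \<bar>u\<bar>" "\<bar>u\<bar> \<le> (1 + \<sigma>) / 2"
  shows "\<not> equal_letters_at_distance fib_word 1 d"
proof
  assume "equal_letters_at_distance fib_word 1 d"
  then obtain i where i: "fib_word !! i = 1" "fib_word !! (i + d) = 1" "fib_word !! (i + 2 * d) = 1"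
    unfolding equal_letters_at_distance_def by blast
  obtain k0 where k0: "0 \<le> real (i + 1) * \<sigma> - of_int k0" "real (i + 1) * \<sigma> - of_int k0 < 1 - \<sigma>"
    using fib_word_nth_oneD[OF i(1)] .
  obtain k1 where k1: "0 \<le> real (i + 1) * \<sigma> + u + of_int z - of_int k1"
      "real (i + 1) * \<sigma> + u + of_int z - of_int k1 < 1 - \<sigma>"
    using fib_word_nth_oneD[OF i(2)] unfolding rotation_shift .
  obtain k2 where k2: "0 \<le> real (i + 1) * \<sigma> + 2 * u + 2 * of_int z - of_int k2"
      "real (i + 1) * \<sigma> + 2 * u + 2 * of_int z - of_int k2 < 1 - \<sigma>"
    using fib_word_nth_oneD[OF i(3)] unfolding rotation_shift .
  define x where "x = real (i + 1) * \<sigma> - of_int k0"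
  define l1 where "l1 = k1 - k0 - z"
  define l2 where "l2 = k2 - k0 - 2 * z"
  have x: "0 \<le> x" "x < 1 - \<sigma>" using k0 by (simp_all add: x_def)
  have x1: "0 \<le> x + u - of_int l1" "x + u - of_int l1 < 1 - \<sigma>"
    using k1 by (simp_all add: x_def l1_def)
  have x2: "0 \<le> x + 2 * u - of_int l2" "x + 2 * u - of_int l2 < 1 - \<sigma>"
    using k2 by (simp_all add: x_def l2_def)
  note b = golden_conj_bounds
  have u1: "- 1 < u" "u < 1" using assms b by auto
  \<comment> \<open>Bounding the wraps leaves finitely many cases, each linear in \<open>x\<close>,
    \<open>u\<close> and \<sigma>.\<close>
  then have "- 2 < real_of_int l1 \<and> real_of_int l1 < 2" using x x1 b by auto
  then have "l1 = -1 \<or> l1 = 0 \<or> l1 = 1" by linarith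
  then have "real_of_int l1 = -1 \<or> real_of_int l1 = 0 \<or> real_of_int l1 = 1" by auto
  moreover have "- 3 < real_of_int l2 \<and> real_of_int l2 < 3" using x x2 u1 b by auto
  then have "l2 = -2 \<or> l2 = -1 \<or> l2 = 0 \<or> l2 = 1 \<or> l2 = 2" by linarith
  then have "real_of_int l2 = -2 \<or> real_of_int l2 = -1 \<or> real_of_int l2 = 0 \<or>
      real_of_int l2 = 1 \<or> real_of_int l2 = 2" by auto
  moreover have "(1 - \<sigma> \<le> 2 * u \<and> 2 * u \<le> 1 + \<sigma>) \<or> (1 - \<sigma> \<le> - 2 * u \<and> - 2 * u \<le> 1 + \<sigma>)"
    using assms by (auto simp: abs_if split: if_splits)
  ultimately show False using x x1 x2 b by (elim disjE conjE; linarith)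
qed

lemma equal_zeros_at_distance_small:
  assumes "\<bar>u\<bar> < \<sigma> / 2"
  shows "equal_letters_at_distance fib_word 0 d"
proof -
  obtain i and k :: int where
    x: "max (1 - \<sigma>) (1 - \<sigma> - 2 * u) < real (i + 1) * \<sigma> - of_int k"
       "real (i + 1) * \<sigma> - of_int k < min 1 (1 - 2 * u)"
    by (rule golden_conj_dense[of "max (1 - \<sigma>) (1 - \<sigma> - 2 * u)" "min 1 (1 - 2 * u)"])
      (use assms golden_conj_bounds in auto)
  have "fib_word !! i = 0" using x by (intro fib_word_nth_zero[where z = k]) auto
  moreover have "fib_word !! (i + d) = 0"
    using x by (intro fib_word_nth_zero[where z = "k + z"];
      simp only: rotation_shift of_int_add of_int_mult of_int_numeral of_int_1; linarith)
  moreover have "fib_word !! (i + 2 * d) = 0"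
    using x by (intro fib_word_nth_zero[where z = "k + 2 * z"];
      simp only: rotation_shift of_int_add of_int_mult of_int_numeral of_int_1; linarith)
  ultimately show ?thesis unfolding equal_letters_at_distance_def by blast
qed

text \<open>The zero interval is longer than \<open>1 / 2\<close>, so the second step may wrap once
  while the first does not: the points are \<open>x\<close>, \<open>x + u\<close>,
  \<open>x + 2 * u - 1\<close>. The upper bound on \<open>x\<close> keeps the middle point below
  one; the lower bound comes from the third point if \<open>u \<le> 1 / 2\<close> and from the first
  otherwise.\<close>

lemma equal_zeros_at_distance_large:
  assumes "1 - \<sigma> < u" "u < \<sigma>"
  shows "equal_letters_at_distance fib_word 0 d"
proof (cases "u \<le> 1 / 2")
  case True
  obtain i and k :: int where
    x: "2 - \<sigma> - 2 * u < real (i + 1) * \<sigma> - of_int k" "real (i + 1) * \<sigma> - of_int k < 1 - u"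
    by (rule golden_conj_dense[of "2 - \<sigma> - 2 * u" "1 - u"]) (use assms True golden_conj_bounds in auto)
  have "fib_word !! i = 0"
    using x assms True golden_conj_bounds by (intro fib_word_nth_zero[where z = k]) auto
  moreover have "fib_word !! (i + d) = 0"
    using x assms True golden_conj_bounds
    by (intro fib_word_nth_zero[where z = "k + z"];
      simp only: rotation_shift of_int_add of_int_mult of_int_numeral of_int_1; linarith)
  moreover have "fib_word !! (i + 2 * d) = 0"
    using x assms True golden_conj_bounds
    by (intro fib_word_nth_zero[where z = "k + 2 * z + 1"];
      simp only: rotation_shift of_int_add of_int_mult of_int_numeral of_int_1; linarith)
  ultimately show ?thesis unfolding equal_letters_at_distance_def by blast
next
  case False
  obtain i and k :: int where
    x: "1 - \<sigma> < real (i + 1) * \<sigma> - of_int k" "real (i + 1) * \<sigma> - of_int k < 1 - u"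
    by (rule golden_conj_dense[of "1 - \<sigma>" "1 - u"]) (use assms False golden_conj_bounds in auto)
  have "fib_word !! i = 0"
    using x assms False golden_conj_bounds by (intro fib_word_nth_zero[where z = k]) auto
  moreover have "fib_word !! (i + d) = 0"
    using x assms False golden_conj_bounds
    by (intro fib_word_nth_zero[where z = "k + z"];
      simp only: rotation_shift of_int_add of_int_mult of_int_numeral of_int_1; linarith)
  moreover have "fib_word !! (i + 2 * d) = 0"
    using x assms False golden_conj_bounds
    by (intro fib_word_nth_zero[where z = "k + 2 * z + 1"];
      simp only: rotation_shift of_int_add of_int_mult of_int_numeral of_int_1; linarith)
  ultimately show ?thesis unfolding equal_letters_at_distance_def by blast
qed

text \<open>Two points of the zero interval differ by less than \<sigma>, while
  \<open>\<bar>u\<bar> \<le> 1 - \<sigma>\<close> keeps \<open>u\<close> at distance at least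
  \<sigma> from every nonzero integer. So neither step wraps, and the outer points give
  \<open>2 * \<bar>u\<bar> < \<sigma>\<close>.\<close>

lemma not_equal_zeros_at_distance:
  assumes "\<sigma> / 2 \<le> \<bar>u\<bar>" "\<bar>u\<bar> \<le> 1 - \<sigma>"
  shows "\<not> equal_letters_at_distance fib_word 0 d"
proof
  assume "equal_letters_at_distance fib_word 0 d"
  then obtain i where i: "fib_word !! i = 0" "fib_word !! (i + d) = 0" "fib_word !! (i + 2 * d) = 0"
    unfolding equal_letters_at_distance_def by blast
  obtain k0 where k0: "1 - \<sigma> \<le> real (i + 1) * \<sigma> - of_int k0" "real (i + 1) * \<sigma> - of_int k0 < 1"
    using fib_word_nth_zeroD[OF i(1)] .
  obtain k1 where k1: "1 - \<sigma> \<le> real (i + 1) * \<sigma> + u + of_int z - of_int k1"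
      "real (i + 1) * \<sigma> + u + of_int z - of_int k1 < 1"
    using fib_word_nth_zeroD[OF i(2)] unfolding rotation_shift .
  obtain k2 where k2: "1 - \<sigma> \<le> real (i + 1) * \<sigma> + 2 * u + 2 * of_int z - of_int k2"
      "real (i + 1) * \<sigma> + 2 * u + 2 * of_int z - of_int k2 < 1"
    using fib_word_nth_zeroD[OF i(3)] unfolding rotation_shift .
  define x where "x = real (i + 1) * \<sigma> - of_int k0"
  define l1 where "l1 = k1 - k0 - z"
  define l2 where "l2 = k2 - k0 - 2 * z"
  have x: "1 - \<sigma> \<le> x" "x < 1" using k0 by (simp_all add: x_def)
  have x1: "1 - \<sigma> \<le> x + u - of_int l1" "x + u - of_int l1 < 1"
    using k1 by (simp_all add: x_def l1_def)
  have x2: "1 - \<sigma> \<le> x + 2 * u - of_int l2" "x + 2 * u - of_int l2 < 1"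
    using k2 by (simp_all add: x_def l2_def)
  note b = golden_conj_bounds
  have u1: "- 1 < u" "u < 1" using assms b by auto
  then have "- 2 < real_of_int l1 \<and> real_of_int l1 < 2" using x x1 b by auto
  then have "l1 = -1 \<or> l1 = 0 \<or> l1 = 1" by linarith
  then have "real_of_int l1 = -1 \<or> real_of_int l1 = 0 \<or> real_of_int l1 = 1" by auto
  moreover have "- 3 < real_of_int l2 \<and> real_of_int l2 < 3" using x x2 u1 b by auto
  then have "l2 = -2 \<or> l2 = -1 \<or> l2 = 0 \<or> l2 = 1 \<or> l2 = 2" by linarith
  then have "real_of_int l2 = -2 \<or> real_of_int l2 = -1 \<or> real_of_int l2 = 0 \<or>
      real_of_int l2 = 1 \<or> real_of_int l2 = 2" by auto
  ultimately show False using x x1 x2 assms b by (elim disjE; linarith)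
qed

end

subsection \<open>Covering the positive integers\<close>

text \<open>For positive parameters and \<open>x \<ge> 0\<close> this counts, with multiplicity, the
  positive multiples of \<open>1 / r\<close>, \<open>1 / s\<close> and \<open>1 / t\<close> up to
  \<open>x\<close>. At \<open>x = m / r\<close> the first floor is \<open>m\<close>, which gives the
  shape of the sequence \<open>a\<close>.\<close>

definition rank_sum :: "real \<Rightarrow> real \<Rightarrow> real \<Rightarrow> real \<Rightarrow> int" where
  "rank_sum r s t x = \<lfloor>x * r\<rfloor> + \<lfloor>x * s\<rfloor> + \<lfloor>x * t\<rfloor>"

text \<open>At \<open>x = p / r\<close> the counting function \<open>rank_sum\<close> reaches \<open>n\<close> for the first time; it cannot
  jump over \<open>n\<close>, because only the multiples of \<open>1 / r\<close> have a point at \<open>x\<close>.\<close>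
lemma rank_sum_first_hit:
  fixes n :: int and p q v :: nat
  assumes pos: "0 < r" "0 < s" "0 < t"
    and p: "1 \<le> p" and q: "1 \<le> q" and v: "1 \<le> v"
    and hit: "n \<le> rank_sum r s t (real p / r)"
    and below: "rank_sum r s t (real (p - 1) / r) < n" "rank_sum r s t (real (q - 1) / s) < n"
      "rank_sum r s t (real (v - 1) / t) < n"
    and first: "real p / r < real q / s" "real p / r < real v / t"
  shows "rank_sum r s t (real p / r) = n"
proof -
  \<comment> \<open>The last candidate point before the first hit. The count at \<open>y\<close> is
    less than \<open>n\<close> and at least \<open>(p - 1) + (q - 1) + (v - 1)\<close>; at
    \<open>p / r\<close> it is at most one more than this sum.\<close>
  define y where "y = max (real (p - 1) / r) (max (real (q - 1) / s) (real (v - 1) / t))"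
  have "rank_sum r s t y < n" using below unfolding y_def by (simp add: max_def)
  moreover have "int (p - 1) \<le> \<lfloor>y * r\<rfloor>" "int (q - 1) \<le> \<lfloor>y * s\<rfloor>" "int (v - 1) \<le> \<lfloor>y * t\<rfloor>"
  proof -
    have "real (p - 1) / r \<le> y" "real (q - 1) / s \<le> y" "real (v - 1) / t \<le> y"
      by (auto simp: y_def)
    then have "real (p - 1) \<le> y * r" "real (q - 1) \<le> y * s" "real (v - 1) \<le> y * t"
      using pos by (simp_all add: pos_divide_le_eq)
    then show "int (p - 1) \<le> \<lfloor>y * r\<rfloor>" "int (q - 1) \<le> \<lfloor>y * s\<rfloor>" "int (v - 1) \<le> \<lfloor>y * t\<rfloor>"
      by (simp_all add: le_floor_iff)
  qed
  moreover have "\<lfloor>real p / r * r\<rfloor> = int p" using pos by simp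
  moreover have "\<lfloor>real p / r * s\<rfloor> < int q" "\<lfloor>real p / r * t\<rfloor> < int v"
  proof -
    have "real p / r * s < real q" "real p / r * t < real v"
      using first pos by (simp_all add: pos_less_divide_eq)
    then show "\<lfloor>real p / r * s\<rfloor> < int q" "\<lfloor>real p / r * t\<rfloor> < int v"
      by (simp_all add: floor_less_iff)
  qed
  ultimately show ?thesis using hit p q v unfolding rank_sum_def by linarith
qed

lemma rank_sum_least:
  fixes n :: int
  assumes pos: "0 < r" "0 < s" "0 < t" and n: "1 \<le> n" and w: "0 < w"
  obtains p where "1 \<le> p" "n \<le> rank_sum r s t (real p / w)" "rank_sum r s t (real (p - 1) / w) < n"
proof -
  let ?P = "\<lambda>k. n \<le> rank_sum r s t (real k / w)"
  \<comment> \<open>Chosen so that the \<open>r\<close> term alone reaches \<open>n\<close>.\<close>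
  obtain k where k: "real_of_int n * w / r \<le> real k" using real_arch_simple by blast
  then have "real_of_int n \<le> real k / w * r" using pos w by (simp add: field_simps)
  then have "n \<le> \<lfloor>real k / w * r\<rfloor>" by (simp add: le_floor_iff)
  moreover have "0 \<le> \<lfloor>real k / w * s\<rfloor>" "0 \<le> \<lfloor>real k / w * t\<rfloor>" using pos w by simp_all
  ultimately have "?P k" unfolding rank_sum_def by linarith
  then have "?P (LEAST k. ?P k)" by (rule LeastI)
  moreover have "(LEAST k. ?P k) \<noteq> 0"
  proof
    assume "(LEAST k. ?P k) = 0"
    with \<open>?P (LEAST k. ?P k)\<close> show False using n by (simp add: rank_sum_def)
  qed
  moreover from this have "\<not> ?P ((LEAST k. ?P k) - 1)" by (intro not_less_Least) simp
  ultimately show ?thesis by (intro that[of "LEAST k. ?P k"]) auto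
qed

text \<open>Each of the three families has a first point where the count reaches \<open>n\<close>.
  Incommensurability makes the earliest of these strict, and there the count is exactly
  \<open>n\<close>; symmetry of \<open>rank_sum\<close> reduces all cases to one.\<close>

lemma rank_sum_cover:
  fixes n :: int
  assumes pos: "0 < r" "0 < s" "0 < t" and n: "1 \<le> n"
    and incomm: "\<And>i j :: nat. 1 \<le> i \<Longrightarrow> 1 \<le> j \<Longrightarrow> real i / r \<noteq> real j / s"
      "\<And>i j :: nat. 1 \<le> i \<Longrightarrow> 1 \<le> j \<Longrightarrow> real i / r \<noteq> real j / t"
      "\<And>i j :: nat. 1 \<le> i \<Longrightarrow> 1 \<le> j \<Longrightarrow> real i / s \<noteq> real j / t"
  obtains m :: nat and w where "1 \<le> m" "w \<in> {r, s, t}" "rank_sum r s t (real m / w) = n"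
proof -
  obtain p where p: "1 \<le> p" "n \<le> rank_sum r s t (real p / r)" "rank_sum r s t (real (p - 1) / r) < n"
    using rank_sum_least[OF pos n pos(1)] .
  obtain q where q: "1 \<le> q" "n \<le> rank_sum r s t (real q / s)" "rank_sum r s t (real (q - 1) / s) < n"
    using rank_sum_least[OF pos n pos(2)] .
  obtain v where v: "1 \<le> v" "n \<le> rank_sum r s t (real v / t)" "rank_sum r s t (real (v - 1) / t) < n"
    using rank_sum_least[OF pos n pos(3)] .
  have comm: "rank_sum s r t x = rank_sum r s t x" "rank_sum t r s x = rank_sum r s t x" for x
    by (simp_all add: rank_sum_def)
  have "real p / r \<noteq> real q / s" "real p / r \<noteq> real v / t" "real q / s \<noteq> real v / t"
    using incomm p q v by blast+
  then consider "real p / r < real q / s" "real p / r < real v / t"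
    | "real q / s < real p / r" "real q / s < real v / t"
    | "real v / t < real p / r" "real v / t < real q / s" by linarith
  then show ?thesis
  proof cases
    case 1
    with p q v pos have "rank_sum r s t (real p / r) = n"
      by (intro rank_sum_first_hit[of r s t p q v n])
    with p that show ?thesis by blast
  next
    case 2
    with p q v pos have "rank_sum s r t (real q / s) = n"
      by (intro rank_sum_first_hit[of s r t q p v n]; simp only: comm)
    with q that show ?thesis unfolding comm by blast
  next
    case 3
    with p q v pos have "rank_sum t r s (real v / t) = n"
      by (intro rank_sum_first_hit[of t r s v p q n]; simp only: comm)
    with v that show ?thesis unfolding comm by blast
  qed
qed

subsection \<open>The three sequences\<close>

text \<open>All three sequences have values of the form \<open>p k + q F + const\<close> with \<open>F = \<lfloor>k \<sigma>\<rfloor>\<close>; multiplying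
  by \<open>\<sigma>\<close> and reducing modulo one uses the following identity.\<close>
lemma floor_golden_conj_mult:
  assumes "x = real k * \<sigma> - of_int F"
  shows "of_int F * \<sigma> = real k - real k * \<sigma> - x * \<sigma>"
proof -
  have "(of_int F + x) * \<sigma> = real k * (\<sigma> * \<sigma>)" using assms by simp
  then show ?thesis unfolding golden_conj_sq by (simp add: algebra_simps)
qed

text \<open>As \<open>x\<close> runs through \<open>(0, 1)\<close>, the representative
  \<open>u\<close> descends from \<sigma> to \<open>1 - \<sigma>\<close>, the range where zeros
  occur by wrapping.\<close>

lemma distance_of_a_even:
  assumes k: "1 \<le> k" and n: "int n = 3 * int k + 2 * \<lfloor>real k * \<sigma>\<rfloor>"
  shows "equal_letters_at_distance fib_word 0 (n + 1) \<and>
    \<not> equal_letters_at_distance fib_word 1 (n + 1)"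
proof -
  define F where "F = \<lfloor>real k * \<sigma>\<rfloor>"
  define x where "x = real k * \<sigma> - of_int F"
  define u where "u = \<sigma> - x * (2 * \<sigma> - 1)"
  note b = golden_conj_bounds
  have "real_of_int (int n) = 3 * real k + 2 * of_int F" unfolding n F_def by simp
  then have "real (n + 1) * \<sigma> = 3 * (real k * \<sigma>) + 2 * (of_int F * \<sigma>) + \<sigma>"
    by (simp add: algebra_simps)
  also have "\<dots> = u + of_int (F + 2 * int k)"
    unfolding floor_golden_conj_mult[OF x_def] by (simp add: u_def x_def algebra_simps)
  finally have eq: "real (n + 1) * \<sigma> = u + of_int (F + 2 * int k)" .
  have "x \<noteq> 0" using golden_conj_mult_not_int[of k F] k by (simp add: x_def)
  moreover have "0 \<le> x" "x < 1" unfolding x_def F_def by linarith+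
  ultimately have "0 < x * (2 * \<sigma> - 1)" "x * (2 * \<sigma> - 1) < 1 * (2 * \<sigma> - 1)"
    using b by (simp, intro mult_strict_right_mono, auto)
  then have "1 - \<sigma> < u" "u < \<sigma>" by (simp_all add: u_def)
  with b show ?thesis
    by (intro conjI equal_zeros_at_distance_large[OF eq] not_equal_ones_at_distance[OF eq]) auto
qed

text \<open>The offsets \<open>\<sigma> / 2\<close> and \<open>\<sigma> / 2 + 1 / 2\<close> carry
  the floors past \<open>F\<close> at the thresholds \<open>1 - \<sigma> / 2\<close> and
  \<open>(1 - \<sigma>) / 2\<close> of \<open>x\<close>. In all three resulting cases
  \<open>(1 - \<sigma>) / 2 \<le> \<bar>u\<bar> < \<sigma> / 2\<close>.\<close>

lemma distance_of_a_odd: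
  assumes n: "int n = 3 * int k + 1 + \<lfloor>real k * \<sigma> + \<sigma> / 2\<rfloor> + \<lfloor>real k * \<sigma> + \<sigma> / 2 + 1 / 2\<rfloor>"
  shows "equal_letters_at_distance fib_word 0 (n + 1) \<and>
    \<not> equal_letters_at_distance fib_word 1 (n + 1)"
proof -
  define F where "F = \<lfloor>real k * \<sigma>\<rfloor>"
  define x where "x = real k * \<sigma> - of_int F"
  define P where "P = x * (2 * \<sigma> - 1)"
  note b = golden_conj_bounds
  have x: "0 \<le> x" "x < 1" unfolding x_def F_def by linarith+
  have kx: "real k * \<sigma> = of_int F + x" by (simp add: x_def)
  \<comment> \<open>In the cases below, \<open>e\<close> is the number of the two floors that equal
    \<open>F + 1\<close>.\<close>
  have d: "real (n + 1) * \<sigma> = (2 + of_int e) * \<sigma> + x - 2 * (x * \<sigma>) + of_int (F + 2 * int k)"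
    if "int n = 3 * int k + 1 + 2 * F + e" for e
  proof -
    have "real_of_int (int n) = 3 * real k + 1 + 2 * of_int F + of_int e" unfolding that by simp
    then have "real (n + 1) * \<sigma> = 3 * (real k * \<sigma>) + 2 * (of_int F * \<sigma>) + (2 + of_int e) * \<sigma>"
      by (simp add: algebra_simps)
    then show ?thesis
      unfolding floor_golden_conj_mult[OF x_def] by (simp add: x_def algebra_simps)
  qed
  have thresholds: "(1 - \<sigma>) / 2 * (2 * \<sigma> - 1) = (5 * \<sigma> - 3) / 2"
      "(1 - \<sigma> / 2) * (2 * \<sigma> - 1) = 7 / 2 * \<sigma> - 2"
    using golden_conj_sq by (simp_all add: field_simps)
  consider (0) "x < (1 - \<sigma>) / 2" | (1) "(1 - \<sigma>) / 2 \<le> x" "x < 1 - \<sigma> / 2" | (2) "1 - \<sigma> / 2 \<le> x"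
    by linarith
  then show ?thesis
  proof cases
    case 0
    have "\<lfloor>real k * \<sigma> + \<sigma> / 2\<rfloor> = F" "\<lfloor>real k * \<sigma> + \<sigma> / 2 + 1 / 2\<rfloor> = F"
      unfolding floor_eq_iff kx using 0 x b by (auto simp: field_simps)
    with n have "int n = 3 * int k + 1 + 2 * F + 0" by simp
    from d[OF this] have eq: "real (n + 1) * \<sigma> = (2 * \<sigma> - 1 - P) + of_int (F + 2 * int k + 1)"
      by (simp add: P_def algebra_simps)
    have "0 \<le> P" unfolding P_def using x b by simp
    moreover have "P < (1 - \<sigma>) / 2 * (2 * \<sigma> - 1)"
      unfolding P_def using 0 b by (intro mult_strict_right_mono) auto
    ultimately show ?thesis using b unfolding thresholds
      by (intro conjI equal_zeros_at_distance_small[OF eq] not_equal_ones_at_distance[OF eq])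
        (auto simp: abs_if)
  next
    case 1
    have "\<lfloor>real k * \<sigma> + \<sigma> / 2\<rfloor> = F" "\<lfloor>real k * \<sigma> + \<sigma> / 2 + 1 / 2\<rfloor> = F + 1"
      unfolding floor_eq_iff kx using 1 x b by (auto simp: field_simps)
    with n have "int n = 3 * int k + 1 + 2 * F + 1" by simp
    from d[OF this] have eq: "real (n + 1) * \<sigma> = (3 * \<sigma> - 2 - P) + of_int (F + 2 * int k + 2)"
      by (simp add: P_def algebra_simps)
    have "(1 - \<sigma>) / 2 * (2 * \<sigma> - 1) \<le> P"
      unfolding P_def using 1 b by (intro mult_right_mono) auto
    moreover have "P < (1 - \<sigma> / 2) * (2 * \<sigma> - 1)"
      unfolding P_def using 1 b by (intro mult_strict_right_mono) auto
    ultimately show ?thesis using b unfolding thresholds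
      by (intro conjI equal_zeros_at_distance_small[OF eq] not_equal_ones_at_distance[OF eq])
        (auto simp: abs_if)
  next
    case 2
    have "\<lfloor>real k * \<sigma> + \<sigma> / 2\<rfloor> = F + 1" "\<lfloor>real k * \<sigma> + \<sigma> / 2 + 1 / 2\<rfloor> = F + 1"
      unfolding floor_eq_iff kx using 2 x b by (auto simp: field_simps)
    with n have "int n = 3 * int k + 1 + 2 * F + 2" by simp
    from d[OF this] have eq: "real (n + 1) * \<sigma> = (4 * \<sigma> - 2 - P) + of_int (F + 2 * int k + 2)"
      by (simp add: P_def algebra_simps)
    \<comment> \<open>Equality would make \<open>(2 * k + 1) * \<sigma>\<close> an integer; it must
      be excluded to get \<open>u < \<sigma> / 2\<close> strictly.\<close>
    have "x \<noteq> 1 - \<sigma> / 2"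
      using golden_conj_mult_not_int[of "2 * k + 1" "2 * F + 2"] by (auto simp: x_def algebra_simps)
    with 2 have "1 - \<sigma> / 2 < x" by simp
    then have "(1 - \<sigma> / 2) * (2 * \<sigma> - 1) < P"
      unfolding P_def using b by (intro mult_strict_right_mono) auto
    moreover have "P < 1 * (2 * \<sigma> - 1)"
      unfolding P_def using x b by (intro mult_strict_right_mono) auto
    ultimately show ?thesis using b unfolding thresholds
      by (intro conjI equal_zeros_at_distance_small[OF eq] not_equal_ones_at_distance[OF eq])
        (auto simp: abs_if)
  qed
qed

text \<open>Division by \<open>r = 2\<close> forces a split by parity: the fractional part of
  \<open>k * \<sigma>\<close> with \<open>k = m div 2\<close> controls both floors.\<close>

lemma distance_of_a:
  assumes m: "1 \<le> m"
    and n: "int n = int m + \<lfloor>real m * \<sigma> / 2\<rfloor> + \<lfloor>real m * (1 + \<sigma>) / 2\<rfloor>"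
  shows "equal_letters_at_distance fib_word 0 (n + 1) \<and>
    \<not> equal_letters_at_distance fib_word 1 (n + 1)"
proof (cases "even m")
  case True
  then obtain k where k: "m = 2 * k" by blast
  have "real m * \<sigma> / 2 = real k * \<sigma>" "real m * (1 + \<sigma>) / 2 = real k * \<sigma> + of_int (int k)"
    by (simp_all add: k algebra_simps)
  with n have "int n = int m + \<lfloor>real k * \<sigma>\<rfloor> + \<lfloor>real k * \<sigma> + of_int (int k)\<rfloor>" by simp
  then have "int n = 3 * int k + 2 * \<lfloor>real k * \<sigma>\<rfloor>" unfolding floor_add_int[symmetric] k by simp
  then show ?thesis using m k by (intro distance_of_a_even) auto
next
  case False
  then obtain k where k: "m = 2 * k + 1" by (auto elim: oddE)
  have "real m * \<sigma> / 2 = real k * \<sigma> + \<sigma> / 2"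
      "real m * (1 + \<sigma>) / 2 = real k * \<sigma> + \<sigma> / 2 + 1 / 2 + of_int (int k)"
    by (simp_all add: k field_simps)
  with n have "int n = int m + \<lfloor>real k * \<sigma> + \<sigma> / 2\<rfloor> +
      \<lfloor>real k * \<sigma> + \<sigma> / 2 + 1 / 2 + of_int (int k)\<rfloor>" by simp
  then have "int n = 3 * int k + 1 + \<lfloor>real k * \<sigma> + \<sigma> / 2\<rfloor> + \<lfloor>real k * \<sigma> + \<sigma> / 2 + 1 / 2\<rfloor>"
    unfolding floor_add_int[symmetric] k by simp
  then show ?thesis by (rule distance_of_a_odd)
qed

text \<open>Since \<open>1 / \<sigma> = 1 + \<sigma>\<close>, both quotients are integer
  combinations of \<open>m\<close> and \<open>m * \<sigma>\<close>, so
  \<open>n = 5 * m + 3 * F + \<lfloor>2 * x\<rfloor>\<close>. Both values of the last floor lead to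
  \<open>\<sigma> / 2 \<le> \<bar>u\<bar> \<le> 1 - \<sigma>\<close>.\<close>

lemma distance_of_b:
  assumes m: "1 \<le> m"
    and n: "int n = int m + \<lfloor>real m * 2 / \<sigma>\<rfloor> + \<lfloor>real m * (1 + \<sigma>) / \<sigma>\<rfloor>"
  shows "\<not> equal_letters_at_distance fib_word 0 (n + 1) \<and>
    \<not> equal_letters_at_distance fib_word 1 (n + 1)"
proof -
  define F where "F = \<lfloor>real m * \<sigma>\<rfloor>"
  define x where "x = real m * \<sigma> - of_int F"
  define P where "P = x * (2 - 3 * \<sigma>)"
  note b = golden_conj_bounds
  have x: "0 \<le> x" "x < 1" unfolding x_def F_def by linarith+
  have mx: "real m * \<sigma> = of_int F + x" by (simp add: x_def)
  have "(1 + \<sigma>) * \<sigma> = 1" "(2 + \<sigma>) * \<sigma> = 1 + \<sigma>" using golden_conj_sq by (simp_all add: algebra_simps)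
  then have inv: "1 / \<sigma> = 1 + \<sigma>" "(1 + \<sigma>) / \<sigma> = 2 + \<sigma>" using b by (simp_all add: divide_eq_eq)
  have "real m * 2 / \<sigma> = real m * 2 * (1 / \<sigma>)" "real m * (1 + \<sigma>) / \<sigma> = real m * ((1 + \<sigma>) / \<sigma>)"
    by simp_all
  then have split: "real m * 2 / \<sigma> = 2 * x + of_int (2 * int m + 2 * F)"
      "real m * (1 + \<sigma>) / \<sigma> = x + of_int (2 * int m + F)"
    unfolding inv using mx by (simp_all add: algebra_simps)
  have n': "int n = 5 * int m + 3 * F + \<lfloor>2 * x\<rfloor>"
    using n x unfolding split floor_add_int[symmetric] by (simp add: floor_eq_iff)
  have d: "real (n + 1) * \<sigma> = P + of_int \<lfloor>2 * x\<rfloor> * \<sigma> + \<sigma> + of_int (2 * F + 3 * int m)"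
  proof -
    have "real_of_int (int n) = 5 * real m + 3 * of_int F + of_int \<lfloor>2 * x\<rfloor>" unfolding n' by simp
    then have "real (n + 1) * \<sigma> =
        5 * (real m * \<sigma>) + 3 * (of_int F * \<sigma>) + of_int \<lfloor>2 * x\<rfloor> * \<sigma> + \<sigma>"
      by (simp add: algebra_simps)
    then show ?thesis
      unfolding floor_golden_conj_mult[OF x_def] by (simp add: P_def x_def algebra_simps)
  qed
  show ?thesis
  proof (cases "x < 1 / 2")
    case True
    with x have "\<lfloor>2 * x\<rfloor> = 0" by (simp add: floor_eq_iff)
    with d have eq: "real (n + 1) * \<sigma> = (P + \<sigma> - 1) + of_int (2 * F + 3 * int m + 1)" by simp
    have "0 \<le> P" unfolding P_def using x b by simp
    moreover have "P \<le> 1 / 2 * (2 - 3 * \<sigma>)"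
      unfolding P_def using True b by (intro mult_right_mono) auto
    ultimately show ?thesis using b
      by (intro conjI not_equal_zeros_at_distance[OF eq] not_equal_ones_at_distance[OF eq])
        (auto simp: abs_if)
  next
    case False
    with x have "\<lfloor>2 * x\<rfloor> = 1" by (simp add: floor_eq_iff)
    with d have eq: "real (n + 1) * \<sigma> = (P + 2 * \<sigma> - 1) + of_int (2 * F + 3 * int m + 1)" by simp
    have "1 / 2 * (2 - 3 * \<sigma>) \<le> P"
      unfolding P_def using False b by (intro mult_right_mono) auto
    moreover have "P \<le> 1 * (2 - 3 * \<sigma>)"
      unfolding P_def using x b by (intro mult_right_mono) auto
    ultimately show ?thesis using b
      by (intro conjI not_equal_zeros_at_distance[OF eq] not_equal_ones_at_distance[OF eq])
        (auto simp: abs_if)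
  qed
qed

text \<open>Now \<open>1 / (1 + \<sigma>) = \<sigma>\<close>, and both values of
  \<open>\<lfloor>2 * x\<rfloor>\<close> lead to \<open>\<bar>u\<bar> < (1 - \<sigma>) / 2\<close>,
  which is below \<open>\<sigma> / 2\<close> as well.\<close>

lemma distance_of_c:
  assumes m: "1 \<le> m"
    and n: "int n = int m + \<lfloor>real m * 2 / (1 + \<sigma>)\<rfloor> + \<lfloor>real m * \<sigma> / (1 + \<sigma>)\<rfloor>"
  shows "equal_letters_at_distance fib_word 0 (n + 1) \<and>
    equal_letters_at_distance fib_word 1 (n + 1)"
proof -
  define F where "F = \<lfloor>real m * \<sigma>\<rfloor>"
  define x where "x = real m * \<sigma> - of_int F"
  define P where "P = x * (1 - \<sigma>)"
  note b = golden_conj_bounds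
  have "x \<noteq> 0" using golden_conj_mult_not_int[of m F] m by (simp add: x_def)
  moreover have "0 \<le> x" "x < 1" unfolding x_def F_def by linarith+
  ultimately have x: "0 < x" "x < 1" by auto
  have mx: "real m * \<sigma> = of_int F + x" by (simp add: x_def)
  have "\<sigma> * (1 + \<sigma>) = 1" "(1 - \<sigma>) * (1 + \<sigma>) = \<sigma>"
    using golden_conj_sq by (simp_all add: algebra_simps)
  then have inv: "1 / (1 + \<sigma>) = \<sigma>" "\<sigma> / (1 + \<sigma>) = 1 - \<sigma>" using b by (simp_all add: divide_eq_eq)
  have "real m * 2 / (1 + \<sigma>) = real m * 2 * (1 / (1 + \<sigma>))"
      "real m * \<sigma> / (1 + \<sigma>) = real m * (\<sigma> / (1 + \<sigma>))"
    by simp_all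
  \<comment> \<open>As \<open>0 < x < 1\<close>, the remainder \<open>1 - x\<close> has floor zero,
    which is where the \<open>- 1\<close> in \<open>n'\<close> comes from.\<close>
  then have split: "real m * 2 / (1 + \<sigma>) = 2 * x + of_int (2 * F)"
      "real m * \<sigma> / (1 + \<sigma>) = (1 - x) + of_int (int m - F - 1)"
    unfolding inv using mx by (simp_all add: algebra_simps)
  have n': "int n = 2 * int m + F - 1 + \<lfloor>2 * x\<rfloor>"
    using n x unfolding split floor_add_int[symmetric] by (simp add: floor_eq_iff)
  have d: "real (n + 1) * \<sigma> = P + of_int \<lfloor>2 * x\<rfloor> * \<sigma> + of_int (F + int m)"
  proof -
    have "real_of_int (int n) = 2 * real m + of_int F - 1 + of_int \<lfloor>2 * x\<rfloor>" unfolding n' by simp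
    then have "real (n + 1) * \<sigma> = 2 * (real m * \<sigma>) + of_int F * \<sigma> + of_int \<lfloor>2 * x\<rfloor> * \<sigma>"
      by (simp add: algebra_simps)
    then show ?thesis
      unfolding floor_golden_conj_mult[OF x_def] by (simp add: P_def x_def algebra_simps)
  qed
  show ?thesis
  proof (cases "x < 1 / 2")
    case True
    with x have "\<lfloor>2 * x\<rfloor> = 0" by (simp add: floor_eq_iff)
    with d have eq: "real (n + 1) * \<sigma> = P + of_int (F + int m)" by simp
    have "0 \<le> P" unfolding P_def using x b by simp
    moreover have "P < 1 / 2 * (1 - \<sigma>)"
      unfolding P_def using True b by (intro mult_strict_right_mono) auto
    ultimately show ?thesis using b
      by (intro conjI equal_zeros_at_distance_small[OF eq] equal_ones_at_distance[OF eq]) auto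
  next
    case False
    with x have "\<lfloor>2 * x\<rfloor> = 1" by (simp add: floor_eq_iff)
    with d have eq: "real (n + 1) * \<sigma> = (P + \<sigma> - 1) + of_int (F + int m + 1)" by simp
    have "x \<noteq> 1 / 2"
      using golden_conj_mult_not_int[of "2 * m" "2 * F + 1"] m by (auto simp: x_def algebra_simps)
    with False have "1 / 2 < x" by simp
    then have "1 / 2 * (1 - \<sigma>) < P"
      unfolding P_def using b by (intro mult_strict_right_mono) auto
    moreover have "P \<le> 1 * (1 - \<sigma>)"
      unfolding P_def using x b by (intro mult_right_mono) auto
    ultimately show ?thesis using b
      by (intro conjI equal_zeros_at_distance_small[OF eq] equal_ones_at_distance[OF eq]) auto
  qed
qed

lemma golden_incommensurable:
  fixes i j :: nat
  assumes "1 \<le> i" "1 \<le> j"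
  shows "real i / 2 \<noteq> real j / \<sigma>" "real i / 2 \<noteq> real j / (1 + \<sigma>)" "real i / \<sigma> \<noteq> real j / (1 + \<sigma>)"
proof -
  note b = golden_conj_bounds
  show "real i / 2 \<noteq> real j / \<sigma>"
    using golden_conj_mult_not_int[of i "2 * int j"] assms b by (auto simp: field_simps)
  show "real i / 2 \<noteq> real j / (1 + \<sigma>)"
    using golden_conj_mult_not_int[of i "2 * int j - int i"] assms b by (auto simp: field_simps)
  show "real i / \<sigma> \<noteq> real j / (1 + \<sigma>)"
  proof
    assume "real i / \<sigma> = real j / (1 + \<sigma>)"
    then have eq: "(real j - real i) * \<sigma> = real i" using b by (simp add: field_simps)
    \<comment> \<open>Positivity gives \<open>i < j\<close>, so that \<open>j - i\<close> is a
      positive natural multiplier of \<sigma>.\<close>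
    then have "0 < (real j - real i) * \<sigma>" using assms by simp
    then have "i < j" using b by (simp add: zero_less_mult_iff)
    with eq golden_conj_mult_not_int[of "j - i" "int i"] show False by (simp add: of_nat_diff)
  qed
qed

theorem theorem17:
  fixes r s t :: real
    and a b c :: "nat \<Rightarrow> int"
    and n :: nat
  assumes "r = 2" and "s = (sqrt 5 - 1) / 2" and "t = (1 + sqrt 5) / 2"
    and "\<And>k. k \<ge> 1 \<Longrightarrow> a k = int k + \<lfloor>real k * s / r\<rfloor> + \<lfloor>real k * t / r\<rfloor>"
    and "\<And>k. k \<ge> 1 \<Longrightarrow> b k = int k + \<lfloor>real k * r / s\<rfloor> + \<lfloor>real k * t / s\<rfloor>"
    and "\<And>k. k \<ge> 1 \<Longrightarrow> c k = int k + \<lfloor>real k * r / t\<rfloor> + \<lfloor>real k * s / t\<rfloor>"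
    and "n \<ge> 1"
  shows "((\<exists>m\<ge>1. int n = a m) \<longleftrightarrow>
            equal_letters_at_distance fib_word 0 (n + 1) \<and>
            \<not> equal_letters_at_distance fib_word 1 (n + 1)) \<and>
         ((\<exists>m\<ge>1. int n = b m) \<longleftrightarrow>
            \<not> equal_letters_at_distance fib_word 0 (n + 1) \<and>
            \<not> equal_letters_at_distance fib_word 1 (n + 1)) \<and>
         ((\<exists>m\<ge>1. int n = c m) \<longleftrightarrow>
            equal_letters_at_distance fib_word 0 (n + 1) \<and>
            equal_letters_at_distance fib_word 1 (n + 1))"
proof -
  have s: "s = \<sigma>" and t: "t = 1 + \<sigma>" using assms(2,3) by (simp_all add: golden_conj_def field_simps)
  note abc = assms(4-6)[unfolded \<open>r = 2\<close> s t]
  let ?zeros = "equal_letters_at_distance fib_word 0 (n + 1)"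
  let ?ones = "equal_letters_at_distance fib_word 1 (n + 1)"
  have a: "?zeros \<and> \<not> ?ones" if "\<exists>m\<ge>1. int n = a m"
    using that abc(1) distance_of_a by metis
  have b: "\<not> ?zeros \<and> \<not> ?ones" if "\<exists>m\<ge>1. int n = b m"
    using that abc(2) distance_of_b by metis
  have c: "?zeros \<and> ?ones" if "\<exists>m\<ge>1. int n = c m"
    using that abc(3) distance_of_c by metis
  have pos: "0 < (2 :: real)" "0 < \<sigma>" "0 < 1 + \<sigma>" using golden_conj_bounds by auto
  have "1 \<le> int n" using \<open>n \<ge> 1\<close> by simp
  then obtain m w where m: "1 \<le> m" and w: "w \<in> {2, \<sigma>, 1 + \<sigma>}"
    and rank: "rank_sum 2 \<sigma> (1 + \<sigma>) (real m / w) = int n"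
    using rank_sum_cover[OF pos _ golden_incommensurable] by metis
  \<comment> \<open>The rank at \<open>m / w\<close> is \<open>a m\<close>, \<open>b m\<close> or
    \<open>c m\<close> according to \<open>w\<close>, because the floor belonging to
    \<open>w\<close> itself is \<open>m\<close>.\<close>
  have "int n = a m \<or> int n = b m \<or> int n = c m"
    using w rank pos abc[OF m] by (auto simp: rank_sum_def)
  with m have "(\<exists>m\<ge>1. int n = a m) \<or> (\<exists>m\<ge>1. int n = b m) \<or> (\<exists>m\<ge>1. int n = c m)" by blast
  with a b c show ?thesis by blast
qed

end
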